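(* Let $G$ be a graph. Let $\tau:V(G)\to\mathbb{N}_0$ be a threshold function for $G$ with $\tau(u)\le d_G(u)$ and $\tau(u)\in\{0,1,d_G(u)\}$ for every vertex $u$ of $G$. Let $X$ be a set of vertices of $G$. Let $U$ be the vertex set of a connected component of order at least $2$ of the induced subgraph $G\big[\{u\in V(G):\tau(u)=d_G(u)\}\big]$. Let $$G'=G-N_G[U]\quad\text{and}\quad \tau'(u)=\max\big\{0,\ \tau(u)-|N_G(u)\cap N_G[U]|\big\}\ \text{ for every vertex } u \text{ of } G'.$$ Then $X$ is a non-monotone target set for $(G,\tau)$ if and only if $N_G[U]\subseteq X$ and $X\setminus N_G[U]$ is a non-monotone target set for $(G',\tau')$. Furthermore, $\tau'(u)\in\{0,1,d_{G'}(u)\}$ for every $u\in V(G')$.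
   Context: Graphs are finite, simple, and undirected. $\mathbb{N}=\{1,2,3,\ldots\}$ and $\mathbb{N}_0=\{0,1,2,\ldots\}$. $d_G(u)$ is the degree of $u$ in $G$ and $N_G(u)$ is the set of neighbors of $u$. For a set $Y$ of vertices of $G$, $N_G(Y)=\left(\bigcup_{u\in Y}N_G(u)\right)\setminus Y$ and $N_G[Y]=Y\cup N_G(Y)$. For a set $Y$ of vertices, $G-Y$ is the subgraph induced by $V(G)\setminus Y$ (possibly with no vertices). The order of a graph is its number of vertices. A threshold function for $G$ is a function $\tau:V(G)\to\mathbb{N}_0$. For $X\subseteq V(G)$, the non-monotone activation process on $(G,\tau)$ starting with $X$ is the sequence $(X_t)_{t\in\mathbb{N}_0}$ with $X_0=X$ and $X_t=\{u\in V(G):|N_G(u)\cap X_{t-1}|\ge\tau(u)\}$ for every $t\in\mathbb{N}$. The set $X$ is a non-monotone target set for $(G,\tau)$ if there is some $t_0\in\mathbb{N}_0$ such that $X_t=V(G)$ for every $t\ge t_0$. *)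

theory Defs
  imports "Graph_Theory.Digraph_Component"
begin

text \<open>
  Finite simple undirected graphs are rendered by the locale \<^locale>\<open>graph\<close>: finite, loop-free,
  symmetric digraphs without parallel arcs. An edge between u and v is represented by the two
  opposite arcs, so the degree of a vertex is its \<^const>\<open>out_degree\<close>, and the connected components
  are the members of \<^const>\<open>pre_digraph.sccs\<close>. The locale allows a graph with no vertices.
\<close>

definition nbrs :: "('a, 'b) pre_digraph \<Rightarrow> 'a \<Rightarrow> 'a set" where
  "nbrs G u = {v. u \<rightarrow>\<^bsub>G\<^esub> v}"

definition open_nbhd :: "('a, 'b) pre_digraph \<Rightarrow> 'a set \<Rightarrow> 'a set" where
  "open_nbhd G Y = (\<Union>u\<in>Y. nbrs G u) - Y"

definition closed_nbhd :: "('a, 'b) pre_digraph \<Rightarrow> 'a set \<Rightarrow> 'a set" where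
  "closed_nbhd G Y = Y \<union> open_nbhd G Y"

definition delete_verts :: "('a, 'b) pre_digraph \<Rightarrow> 'a set \<Rightarrow> ('a, 'b) pre_digraph" where
  "delete_verts G Y = G \<restriction> (verts G - Y)"

text \<open>
  A threshold function is a function on the whole vertex type; its values outside of
  the vertex set of the graph play no role.
\<close>

primrec activation ::
  "('a, 'b) pre_digraph \<Rightarrow> ('a \<Rightarrow> nat) \<Rightarrow> 'a set \<Rightarrow> nat \<Rightarrow> 'a set" where
  "activation G \<tau> X 0 = X"
| "activation G \<tau> X (Suc t) =
     {u \<in> verts G. card (nbrs G u \<inter> activation G \<tau> X t) \<ge> \<tau> u}"

definition nonmonotone_target_set ::
  "('a, 'b) pre_digraph \<Rightarrow> ('a \<Rightarrow> nat) \<Rightarrow> 'a set \<Rightarrow> bool" where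
  "nonmonotone_target_set G \<tau> X \<longleftrightarrow>
     X \<subseteq> verts G \<and> (\<exists>t0. \<forall>t\<ge>t0. activation G \<tau> X t = verts G)"

end

theory Submission
  imports Defs
begin

text \<open>
  A vertex \<open>u\<close> with \<open>\<tau> u = d(u)\<close> becomes active exactly when all its neighbours were active.
  Every vertex of \<open>N[U]\<close> has a neighbour in \<open>U\<close>, so an inactive vertex of \<open>N[U]\<close> makes some
  vertex of \<open>U\<close> inactive in the next round; hence a target set contains \<open>N[U]\<close>, now and in
  every later round. Conversely, vertices of \<open>N(U)\<close> have threshold at most \<open>1\<close> because \<open>U\<close> is a
  component, so \<open>N[U]\<close> stays active once it is active. While \<open>N[U]\<close> is active, the process
  outside of \<open>N[U]\<close> is the process on \<open>G'\<close> with the reduced thresholds.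
\<close>

context graph
begin

lemma nbrs_subset: "nbrs G u \<subseteq> verts G"
  by (auto simp: nbrs_def)

lemma finite_nbrs: "finite (nbrs G u)"
  using nbrs_subset finite_verts by (rule finite_subset)

lemma nbrs_sym: "v \<in> nbrs G u \<Longrightarrow> u \<in> nbrs G v"
  by (auto simp: nbrs_def intro: graph_symmetric)

text \<open>\<open>out_degree\<close> counts arcs. Without parallel arcs, \<open>head G\<close> is
  injective on the arcs leaving \<open>u\<close>, so counting arcs is counting neighbours.\<close>

lemma out_degree_eq_card_nbrs: "out_degree G u = card (nbrs G u)"
proof -
  have "head G ` out_arcs G u = nbrs G u"
    by (auto simp: nbrs_def arcs_ends_conv image_iff)
  moreover have "inj_on (head G) (out_arcs G u)"
    by (auto intro!: inj_onI no_multi_arcs simp: arc_to_ends_def)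
  ultimately show ?thesis
    by (metis card_image out_degree_def)
qed

lemma verts_delete_verts: "verts (delete_verts G Y) = verts G - Y"
  by (simp add: delete_verts_def)

lemma graph_induce_subgraph:
  assumes "S \<subseteq> verts G"
  shows "graph (G \<restriction> S)"
proof -
  have ind: "induced_subgraph (G \<restriction> S) G"
    using assms by (rule induced_induce)
  show ?thesis
    by (intro graph.intro pseudo_graph.intro digraphI_induced[OF ind]
        induced_graph_imp_graph[OF ind] digraph.axioms(1))
qed

lemma graph_delete_verts: "graph (delete_verts G Y)"
  unfolding delete_verts_def by (rule graph_induce_subgraph) blast

lemma nbrs_delete_verts:
  "u \<in> verts G - Y \<Longrightarrow> nbrs (delete_verts G Y) u = nbrs G u - Y"
  by (auto simp: nbrs_def delete_verts_def arcs_ends_conv image_iff dest: wellformed)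

text \<open>A subset of the finite set \<open>nbrs G u\<close> with at least as many elements is the
  whole set. This turns the threshold condition at vertices with full threshold into an
  inclusion.\<close>

lemma card_nbrs_Int_ge_out_degree_iff:
  "out_degree G u \<le> card (nbrs G u \<inter> A) \<longleftrightarrow> nbrs G u \<subseteq> A"
proof
  assume "out_degree G u \<le> card (nbrs G u \<inter> A)"
  then have "nbrs G u \<inter> A = nbrs G u"
    using card_seteq[OF finite_nbrs Int_lower1] by (simp add: out_degree_eq_card_nbrs)
  then show "nbrs G u \<subseteq> A" by blast
qed (simp add: out_degree_eq_card_nbrs Int_absorb2)

text \<open>As \<open>Y\<close> is active in every round, it always contributes exactly
  \<open>card (nbrs G u \<inter> Y)\<close> to the count at \<open>u\<close>. Lowering the threshold
  by this constant compensates for deleting \<open>Y\<close>; truncated subtraction is harmless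
  because \<open>a - b \<le> c\<close> iff \<open>a \<le> b + c\<close>.\<close>

lemma activation_delete_verts:
  assumes sub: "\<And>t. Y \<subseteq> activation G \<tau> X t"
    and red: "\<And>u. u \<in> verts G - Y \<Longrightarrow> \<tau>' u = \<tau> u - card (nbrs G u \<inter> Y)"
  shows "activation (delete_verts G Y) \<tau>' (X - Y) t = activation G \<tau> X t - Y"
proof (induction t)
  case 0
  then show ?case by simp
next
  case (Suc t)
  let ?A = "activation G \<tau> X t"
  have "\<tau>' u \<le> card (nbrs (delete_verts G Y) u \<inter> (?A - Y)) \<longleftrightarrow> \<tau> u \<le> card (nbrs G u \<inter> ?A)"
    if u: "u \<in> verts G - Y" for u
  proof -
    have "nbrs G u \<inter> ?A = (nbrs G u \<inter> Y) \<union> ((nbrs G u - Y) \<inter> (?A - Y))"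
      using sub by blast
    then have "card (nbrs G u \<inter> ?A) = card (nbrs G u \<inter> Y) + card ((nbrs G u - Y) \<inter> (?A - Y))"
      by (metis (no_types, lifting) Diff_disjoint Int_assoc Int_commute Int_empty_right
          card_Un_disjoint finite_Diff finite_Int finite_nbrs)
    then show ?thesis
      using u by (auto simp: red nbrs_delete_verts)
  qed
  then show ?case
    unfolding activation.simps Suc.IH verts_delete_verts by blast
qed

lemma closed_nbhd_subset: "Y \<subseteq> verts G \<Longrightarrow> closed_nbhd G Y \<subseteq> verts G"
  using nbrs_subset by (auto simp: closed_nbhd_def open_nbhd_def)

lemma closed_nbhd_subset_activation_pred:
  assumes nbr: "\<And>u. u \<in> Y \<Longrightarrow> nbrs G u \<inter> Y \<noteq> {}"
    and full: "\<And>u. u \<in> Y \<Longrightarrow> \<tau> u = out_degree G u"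
    and act: "closed_nbhd G Y \<subseteq> activation G \<tau> X (Suc t)"
  shows "closed_nbhd G Y \<subseteq> activation G \<tau> X t"
proof
  fix v
  assume "v \<in> closed_nbhd G Y"
  then have "v \<in> Y \<or> (\<exists>w\<in>Y. v \<in> nbrs G w)"
    by (auto simp: closed_nbhd_def open_nbhd_def)
  \<comment> \<open>If \<open>v\<close> itself lies in \<open>Y\<close>, the neighbour
    \<open>w\<close> in \<open>Y\<close> comes from \<open>nbr\<close>; otherwise it comes from the
    definition of the open neighbourhood.\<close>
  then obtain w where "w \<in> Y" "v \<in> nbrs G w"
    using nbr nbrs_sym by blast
  moreover have "w \<in> activation G \<tau> X (Suc t)"
    using \<open>w \<in> Y\<close> act by (auto simp: closed_nbhd_def)
  ultimately show "v \<in> activation G \<tau> X t"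
    using full[of w] card_nbrs_Int_ge_out_degree_iff[of w "activation G \<tau> X t"] by auto
qed

lemma closed_nbhd_subset_activation_Suc:
  assumes "Y \<subseteq> verts G"
    and full: "\<And>u. u \<in> Y \<Longrightarrow> \<tau> u = out_degree G u"
    and open1: "\<And>u. u \<in> open_nbhd G Y \<Longrightarrow> \<tau> u \<le> 1"
    and act: "closed_nbhd G Y \<subseteq> activation G \<tau> X t"
  shows "closed_nbhd G Y \<subseteq> activation G \<tau> X (Suc t)"
proof
  fix v
  assume v: "v \<in> closed_nbhd G Y"
  have "\<tau> v \<le> card (nbrs G v \<inter> activation G \<tau> X t)"
  proof (cases "v \<in> Y")
    case True
    then have "nbrs G v \<subseteq> activation G \<tau> X t"
      using act by (auto simp: closed_nbhd_def open_nbhd_def)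
    then show ?thesis
      using True full card_nbrs_Int_ge_out_degree_iff by auto
  next
    case False
    then have v': "v \<in> open_nbhd G Y"
      using v by (auto simp: closed_nbhd_def)
    then obtain w where "w \<in> Y" "w \<in> nbrs G v"
      using nbrs_sym by (auto simp: open_nbhd_def)
    then have "w \<in> nbrs G v \<inter> activation G \<tau> X t"
      using act by (auto simp: closed_nbhd_def)
    then have "card (nbrs G v \<inter> activation G \<tau> X t) \<ge> 1"
      by (metis One_nat_def Suc_leI card_gt_0_iff empty_iff finite_Int finite_nbrs)
    then show ?thesis
      using open1[OF v'] by linarith
  qed
  moreover have "v \<in> verts G"
    using v closed_nbhd_subset assms(1) by blast
  ultimately show "v \<in> activation G \<tau> X (Suc t)"
    by simp
qed

text \<open>Only these local properties of the component \<open>U\<close> matter for the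
  equivalence, so it is proved for any \<open>Y\<close> that has them.\<close>

lemma nonmonotone_target_set_iff_delete_closed_nbhd:
  assumes Y: "Y \<subseteq> verts G"
    and nbr: "\<And>u. u \<in> Y \<Longrightarrow> nbrs G u \<inter> Y \<noteq> {}"
    and full: "\<And>u. u \<in> Y \<Longrightarrow> \<tau> u = out_degree G u"
    and open1: "\<And>u. u \<in> open_nbhd G Y \<Longrightarrow> \<tau> u \<le> 1"
    and red: "\<And>u. u \<in> verts G - closed_nbhd G Y \<Longrightarrow>
      \<tau>' u = \<tau> u - card (nbrs G u \<inter> closed_nbhd G Y)"
  shows "nonmonotone_target_set G \<tau> X \<longleftrightarrow> closed_nbhd G Y \<subseteq> X \<and>
    nonmonotone_target_set (delete_verts G (closed_nbhd G Y)) \<tau>' (X - closed_nbhd G Y)"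
    (is "_ \<longleftrightarrow> ?N \<subseteq> X \<and> _")
proof -
  have N: "?N \<subseteq> verts G"
    using Y by (rule closed_nbhd_subset)
  have start: "?N \<subseteq> X" if "nonmonotone_target_set G \<tau> X"
  proof -
    obtain t where "activation G \<tau> X t = verts G"
      using \<open>nonmonotone_target_set G \<tau> X\<close> by (auto simp: nonmonotone_target_set_def)
    then have "?N \<subseteq> activation G \<tau> X t"
      using N by simp
    \<comment> \<open>The induction runs back in time, from a round in which all vertices are active
      to round 0.\<close>
    then show ?thesis
    proof (induction t)
      case 0
      then show ?case by simp
    next
      case (Suc t)
      from Suc.prems have "?N \<subseteq> activation G \<tau> X t"
        using closed_nbhd_subset_activation_pred[of Y \<tau> X t] nbr full by blast
      then show ?case by (rule Suc.IH)
    qed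
  qed
  have "nonmonotone_target_set G \<tau> X \<longleftrightarrow>
      nonmonotone_target_set (delete_verts G ?N) \<tau>' (X - ?N)" if "?N \<subseteq> X"
  proof -
    have act: "?N \<subseteq> activation G \<tau> X t" for t
    proof (induction t)
      case 0
      then show ?case using \<open>?N \<subseteq> X\<close> by simp
    next
      case (Suc t)
      then show ?case
        using closed_nbhd_subset_activation_Suc[of Y \<tau> X t] Y full open1 by blast
    qed
    have "activation (delete_verts G ?N) \<tau>' (X - ?N) t = activation G \<tau> X t - ?N" for t
      using act red by (rule activation_delete_verts)
    then have "activation (delete_verts G ?N) \<tau>' (X - ?N) t = verts (delete_verts G ?N) \<longleftrightarrow>
        activation G \<tau> X t = verts G" for t
      using act[of t] N by (auto simp: verts_delete_verts)
    moreover have "X - ?N \<subseteq> verts (delete_verts G ?N) \<longleftrightarrow> X \<subseteq> verts G"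
      using N by (auto simp: verts_delete_verts)
    ultimately show ?thesis
      by (simp add: nonmonotone_target_set_def)
  qed
  with start show ?thesis by blast
qed

text \<open>Degrees drop by the same amount as the thresholds, so a vertex whose threshold equals
  its degree keeps this property after the deletion.\<close>

lemma out_degree_delete_verts:
  assumes "u \<in> verts G - Y"
  shows "out_degree (delete_verts G Y) u = out_degree G u - card (nbrs G u \<inter> Y)"
  using assms
  by (simp add: graph.out_degree_eq_card_nbrs[OF graph_delete_verts] out_degree_eq_card_nbrs
      nbrs_delete_verts card_Diff_subset_Int finite_nbrs)

end

lemma (in wf_digraph) ex_nbr_in_scc:
  assumes C: "C \<in> sccs" and "u \<in> verts C" and "card (verts C) \<ge> 2"
  shows "nbrs G u \<inter> verts C \<noteq> {}"
proof -
  have sub: "subgraph C G" and conn: "strongly_connected C"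
    using C by (auto simp: sccs_def induced_subgraph_def)
  interpret C: wf_digraph C
    using sub by auto
  have "verts C \<noteq> {u}"
    using assms(3) by auto
  then obtain v where v: "v \<in> verts C" "v \<noteq> u"
    using assms(2) by blast
  have "u \<rightarrow>\<^sup>*\<^bsub>C\<^esub> v"
    using conn assms(2) v by (auto simp: strongly_connected_def)
  \<comment> \<open>The first arc of a walk from \<open>u\<close> to \<open>v\<close> is wanted; the
    premise \<open>u \<noteq> v\<close> makes the case of the empty walk vacuous.\<close>
  then have "u \<noteq> v \<longrightarrow> (\<exists>w. u \<rightarrow>\<^bsub>C\<^esub> w)"
    by (induction rule: C.converse_reachable_induct) auto
  then obtain w where w: "u \<rightarrow>\<^bsub>C\<^esub> w"
    using v by blast
  then have "w \<in> verts C" "u \<rightarrow>\<^bsub>G\<^esub> w"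
    using arcs_ends_mono[OF sub] by (auto dest: C.adj_in_verts)
  then show ?thesis
    by (auto simp: nbrs_def)
qed

text \<open>By symmetry, adjacent vertices reach each other and hence share a component.\<close>

lemma (in sym_digraph) nbrs_scc_subset:
  assumes C: "C \<in> sccs" and "u \<in> verts C"
  shows "nbrs G u \<subseteq> verts C"
proof
  fix v
  assume "v \<in> nbrs G u"
  then have "u \<rightarrow>\<^sup>* v" "v \<rightarrow>\<^sup>* u"
    by (auto simp: nbrs_def intro: graph_symmetric)
  moreover have "verts C \<in> sccs_verts"
    using C by (auto intro: in_sccs_vertsI_sccs)
  ultimately show "v \<in> verts C"
    using assms(2) by (auto simp: in_sccs_verts_conv_reachable)
qed

theorem lemma1:
  fixes G G' C :: "('a, 'b) pre_digraph"
    and \<tau> \<tau>' :: "'a \<Rightarrow> nat"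
    and X U :: "'a set"
  assumes "graph G"
    and "\<And>u. u \<in> verts G \<Longrightarrow> \<tau> u \<le> out_degree G u"
    and "\<And>u. u \<in> verts G \<Longrightarrow> \<tau> u \<in> {0, 1, out_degree G u}"
    and "X \<subseteq> verts G"
    and "C \<in> pre_digraph.sccs (G \<restriction> {u \<in> verts G. \<tau> u = out_degree G u})"
    and "U = verts C"
    and "card U \<ge> 2"
    and "G' = delete_verts G (closed_nbhd G U)"
    and "\<And>u. u \<in> verts G' \<Longrightarrow>
      int (\<tau>' u) = max 0 (int (\<tau> u) - int (card (nbrs G u \<inter> closed_nbhd G U)))"
  shows "(nonmonotone_target_set G \<tau> X \<longleftrightarrow>
      closed_nbhd G U \<subseteq> X \<and> nonmonotone_target_set G' \<tau>' (X - closed_nbhd G U))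
    \<and> (\<forall>u \<in> verts G'. \<tau>' u \<in> {0, 1, out_degree G' u})"
proof -
  interpret graph G by fact
  let ?D = "{u \<in> verts G. \<tau> u = out_degree G u}"
  interpret H: graph "G \<restriction> ?D"
    by (rule graph_induce_subgraph) blast
  have U: "U \<subseteq> ?D"
    using assms(5,6) by (auto simp: H.sccs_def induced_subgraph_def subgraph_def)
  \<comment> \<open>The maximum with 0 over the integers is truncated subtraction on the
    naturals.\<close>
  have red: "\<tau>' u = \<tau> u - card (nbrs G u \<inter> closed_nbhd G U)"
    if "u \<in> verts G - closed_nbhd G U" for u
    using assms(9)[of u] that by (auto simp: assms(8) verts_delete_verts)
  have nbr: "nbrs G u \<inter> U \<noteq> {}" if "u \<in> U" for u
  proof -
    have "nbrs (G \<restriction> ?D) u \<inter> U \<noteq> {}"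
      using H.ex_nbr_in_scc[OF assms(5)] that assms(6,7) by simp
    moreover have "nbrs (G \<restriction> ?D) u \<subseteq> nbrs G u"
      unfolding nbrs_def by (rule Collect_mono) (blast dest: dominates_induce_subgraphD)
    ultimately show ?thesis by blast
  qed
  \<comment> \<open>A threshold above 1 would have to equal the degree. Then \<open>u\<close> would
    be a vertex of the induced subgraph adjacent to \<open>U\<close>, and so would belong to the
    component \<open>U\<close> itself.\<close>
  have open1: "\<tau> u \<le> 1" if u: "u \<in> open_nbhd G U" for u
  proof (rule ccontr)
    assume "\<not> \<tau> u \<le> 1"
    obtain w where w: "w \<in> U" "u \<in> nbrs G w" "u \<notin> U"
      using u by (auto simp: open_nbhd_def)
    with \<open>\<not> \<tau> u \<le> 1\<close> assms(3)[of u] nbrs_subset have "u \<in> ?D"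
      by auto
    with w U have "u \<in> nbrs (G \<restriction> ?D) w"
      by (auto simp: nbrs_def arcs_ends_conv image_iff)
    with w H.nbrs_scc_subset[OF assms(5)] assms(6) show False
      by blast
  qed
  have "\<tau>' u \<in> {0, 1, out_degree G' u}" if "u \<in> verts G'" for u
  proof -
    have "u \<in> verts G - closed_nbhd G U"
      using that by (simp add: assms(8) verts_delete_verts)
    \<comment> \<open>Thresholds 0 and 1 stay in {0, 1} under truncated subtraction, and a full
      threshold becomes the degree in \<open>G'\<close>.\<close>
    then show ?thesis
      using assms(3)[of u] by (auto simp: red assms(8) out_degree_delete_verts)
  qed
  moreover have "nonmonotone_target_set G \<tau> X \<longleftrightarrow>
      closed_nbhd G U \<subseteq> X \<and> nonmonotone_target_set G' \<tau>' (X - closed_nbhd G U)"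
    unfolding assms(8)
    by (rule nonmonotone_target_set_iff_delete_closed_nbhd) (use U nbr open1 red in auto)
  ultimately show ?thesis by blast
qed

end
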